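(* Let $\emptyset\neq\mathcal{X}\subseteq\{0,1\}^n$, $\hat c\in\mathbb{R}^n_{\ge 0}$, and let $B\subset\mathbb{R}^n$ be a convex set containing the origin such that $\max_{c\in B}c^tx$ exists for every $x\in\mathcal{X}$. Let $\mathcal{E}_{\min}$ be a maximal subset of the set of efficient extreme solutions containing no two equivalent solutions. Then $\mathcal{E}_{\min}$ is a solution of the variable-sized robust optimization problem, i.e.: (I) for every $\lambda\ge 0$ the set $\mathcal{E}_{\min}$ contains an optimal solution of $\min_{x\in\mathcal{X}}\max_{c\in\mathcal{U}_\lambda}c^tx$, where $\mathcal{U}_\lambda=\{\hat c\}+\lambda B$; and (II) $\mathcal{E}_{\min}$ is a smallest possible subset of $\mathcal{X}$ with property (I).
   Context: For $\lambda\ge0$ let $\mathcal{U}_\lambda=\{\hat c\}+\lambda B$ and consider $\mathsf{P}(\lambda)$: $\min_{x\in\mathcal{X}}\max_{c\in\mathcal{U}_\lambda}c^tx$. The variable-sized robust optimization problem asks for a set $\mathcal{S}\subset\mathcal{X}$ of smallest possible size such that for every $\lambda\ge0$, $\mathcal{S}$ contains an optimal solution of $\mathsf{P}(\lambda)$. Put $f_1(x)=\hat c^tx$, $f_2(x)=\max_{c\in B}c^tx$, so that the objective of $\mathsf{P}(\lambda)$ is $f_1(x)+\lambda f_2(x)$. Let $F(x)=(f_1(x),f_2(x))^t$ and $\mathcal{V}=\operatorname{conv}(\{F(x):x\in\mathcal{X}\})+\mathbb{R}^2_+$. A solution $x\in\mathcal{X}$ is an efficient extreme solution if $F(x)$ is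 a vertex of $\mathcal{V}$. Two solutions $x\ne x'$ are equivalent if $F(x)=F(x')$. *)

theory Defs
  imports "HOL-Analysis.Analysis" "HOL-Library.Set_Algebras"
begin

text \<open>\<open>Greatest\<close> is unspecified if the maximum is not attained; attainment over \<open>B\<close> is a
  hypothesis wherever these values are used.\<close>

definition worst_case :: "(real ^ 'n) set \<Rightarrow> real ^ 'n \<Rightarrow> real" where
  "worst_case U x = (GREATEST v. v \<in> (\<lambda>c. c \<bullet> x) ` U)"

definition uncertainty_set :: "real ^ 'n \<Rightarrow> (real ^ 'n) set \<Rightarrow> real \<Rightarrow> (real ^ 'n) set" where
  "uncertainty_set chat B l = {chat} + (\<lambda>b. l *\<^sub>R b) ` B"

definition robust_optimal ::
  "(real ^ 'n) set \<Rightarrow> real ^ 'n \<Rightarrow> (real ^ 'n) set \<Rightarrow> real \<Rightarrow> real ^ 'n \<Rightarrow> bool" where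
  "robust_optimal X chat B l x \<longleftrightarrow>
     is_arg_min (worst_case (uncertainty_set chat B l)) (\<lambda>y. y \<in> X) x"

definition contains_optimum_for_all_sizes ::
  "(real ^ 'n) set \<Rightarrow> real ^ 'n \<Rightarrow> (real ^ 'n) set \<Rightarrow> (real ^ 'n) set \<Rightarrow> bool" where
  "contains_optimum_for_all_sizes X chat B S \<longleftrightarrow> (\<forall>l\<ge>0. \<exists>x\<in>S. robust_optimal X chat B l x)"

definition F :: "real ^ 'n \<Rightarrow> (real ^ 'n) set \<Rightarrow> real ^ 'n \<Rightarrow> real \<times> real" where
  "F chat B x = (chat \<bullet> x, worst_case B x)"

definition V :: "(real ^ 'n) set \<Rightarrow> real ^ 'n \<Rightarrow> (real ^ 'n) set \<Rightarrow> (real \<times> real) set" where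
  "V X chat B = convex hull (F chat B ` X) + {v. 0 \<le> fst v \<and> 0 \<le> snd v}"

definition efficient_extreme ::
  "(real ^ 'n) set \<Rightarrow> real ^ 'n \<Rightarrow> (real ^ 'n) set \<Rightarrow> (real ^ 'n) set" where
  "efficient_extreme X chat B = {x \<in> X. F chat B x extreme_point_of V X chat B}"

definition equivalent ::
  "real ^ 'n \<Rightarrow> (real ^ 'n) set \<Rightarrow> real ^ 'n \<Rightarrow> real ^ 'n \<Rightarrow> bool" where
  "equivalent chat B x x' \<longleftrightarrow> x \<noteq> x' \<and> F chat B x = F chat B x'"

definition inequivalent_efficient ::
  "(real ^ 'n) set \<Rightarrow> real ^ 'n \<Rightarrow> (real ^ 'n) set \<Rightarrow> (real ^ 'n) set \<Rightarrow> bool" where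
  "inequivalent_efficient X chat B E \<longleftrightarrow>
     E \<subseteq> efficient_extreme X chat B \<and> (\<forall>x\<in>E. \<forall>x'\<in>E. \<not> equivalent chat B x x')"

text \<open>Maximality is with respect to inclusion.\<close>

definition maximal_inequivalent_efficient ::
  "(real ^ 'n) set \<Rightarrow> real ^ 'n \<Rightarrow> (real ^ 'n) set \<Rightarrow> (real ^ 'n) set \<Rightarrow> bool" where
  "maximal_inequivalent_efficient X chat B E \<longleftrightarrow>
     inequivalent_efficient X chat B E \<and>
     (\<forall>E'. inequivalent_efficient X chat B E' \<and> E \<subseteq> E' \<longrightarrow> E' = E)"

end

theory Submission
  imports Defs
begin

text \<open>Passing from \<open>B\<close> to \<open>{chat} + l B\<close> turns the objective into \<open>f\<^sub>1 + l f\<^sub>2\<close>, so everything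
  happens in the plane. For given \<open>l\<close>, a lexicographic minimiser of \<open>(f\<^sub>1 + l f\<^sub>2, f\<^sub>2)\<close> is an
  efficient extreme solution, which gives an optimum in \<open>Emin\<close>. Conversely, finiteness of \<open>X\<close>
  makes every vertex of \<open>V\<close> the unique minimal value of \<open>f\<^sub>1 + l f\<^sub>2\<close> for a suitable finite
  \<open>l \<ge> 0\<close>, so any competing set has to attain every vertex.\<close>

section \<open>The robust objective as a weighted sum; finiteness tools\<close>

lemma worst_case_uncertainty_set:
  assumes "c \<in> B" "\<And>c'. c' \<in> B \<Longrightarrow> c' \<bullet> x \<le> c \<bullet> x" "0 \<le> l"
  shows "worst_case (uncertainty_set chat B l) x = fst (F chat B x) + l * snd (F chat B x)"
proof -
  have "worst_case B x = c \<bullet> x"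
    unfolding worst_case_def using assms(1,2) by (intro Greatest_equality) auto
  \<comment> \<open>Scaling by \<open>l \<ge> 0\<close> and translating by \<open>chat\<close> keep
    a maximiser a maximiser, so \<open>chat + l *\<^sub>R c\<close> attains the new maximum.\<close>
  moreover have "worst_case (uncertainty_set chat B l) x = chat \<bullet> x + l * (c \<bullet> x)"
    unfolding worst_case_def
  proof (rule Greatest_equality)
    have "(chat + l *\<^sub>R c) \<bullet> x \<in> (\<lambda>c. c \<bullet> x) ` uncertainty_set chat B l"
      using assms(1) unfolding uncertainty_set_def by (intro imageI set_plus_intro) auto
    then show "chat \<bullet> x + l * (c \<bullet> x) \<in> (\<lambda>c. c \<bullet> x) ` uncertainty_set chat B l"
      by (simp add: inner_left_distrib)
  next
    fix v assume "v \<in> (\<lambda>c. c \<bullet> x) ` uncertainty_set chat B l"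
    then obtain b where "b \<in> B" "v = chat \<bullet> x + l * (b \<bullet> x)"
      unfolding uncertainty_set_def by (auto simp: set_plus_def inner_left_distrib)
    then show "v \<le> chat \<bullet> x + l * (c \<bullet> x)"
      using assms(2,3) by (simp add: mult_left_mono)
  qed
  ultimately show ?thesis by (simp add: F_def)
qed

lemma finite_binary_vectors: "finite {x :: real ^ 'n. \<forall>i. x $ i \<in> {0, 1}}"
proof -
  have "finite ((\<lambda>f. \<chi> i. f i) ` (UNIV \<rightarrow>\<^sub>E {0, 1 :: real}) :: (real ^ 'n) set)"
    by (intro finite_imageI finite_PiE) auto
  moreover have "{x :: real ^ 'n. \<forall>i. x $ i \<in> {0, 1}} \<subseteq> (\<lambda>f. \<chi> i. f i) ` (UNIV \<rightarrow>\<^sub>E {0, 1})"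
  proof
    fix x :: "real ^ 'n" assume "x \<in> {x. \<forall>i. x $ i \<in> {0, 1}}"
    then have "(\<lambda>i. x $ i) \<in> UNIV \<rightarrow>\<^sub>E {0, 1}" by auto
    moreover have "x = (\<chi> i. x $ i)" by (simp add: vec_eq_iff)
    ultimately show "x \<in> (\<lambda>f. \<chi> i. f i) ` (UNIV \<rightarrow>\<^sub>E {0, 1})" by blast
  qed
  ultimately show ?thesis by (rule finite_subset[rotated])
qed

text \<open>This will supply the weight \<open>l\<close> from finitely many strict lower and upper
  bounds. Unboundedness of the order covers the case that one kind of bound is absent.\<close>

lemma finite_sets_separated:
  fixes L U :: "'a :: {unbounded_dense_linorder} set"
  assumes "finite L" "finite U" "\<And>a b. a \<in> L \<Longrightarrow> b \<in> U \<Longrightarrow> a < b"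
  shows "\<exists>m. (\<forall>a\<in>L. a < m) \<and> (\<forall>b\<in>U. m < b)"
proof (cases "L = {} \<or> U = {}")
  case True
  then show ?thesis
  proof
    assume "L = {}"
    then show ?thesis using assms(2) lt_ex[of "Min U"] by (cases "U = {}") auto
  next
    assume "U = {}"
    then show ?thesis using assms(1) gt_ex[of "Max L"] by (cases "L = {}") auto
  qed
next
  case False
  then have "Max L < Min U" using assms by simp
  then obtain m where "Max L < m" "m < Min U" using dense by blast
  then show ?thesis using False assms(1,2) by (auto intro!: exI[of _ m])
qed

section \<open>Vertices as unique minima of weighted sums\<close>

abbreviation quadrant :: "(real \<times> real) set" where
  "quadrant \<equiv> {v. 0 \<le> fst v \<and> 0 \<le> snd v}"

text \<open>Since \<open>p - s\<close> lies in the quadrant, the reflection of \<open>s\<close> in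
  \<open>p\<close> stays in the set. If \<open>s\<close> differed from \<open>p\<close>, then
  \<open>p\<close> would be the midpoint of a proper segment.\<close>

lemma extreme_point_not_dominated:
  assumes "p extreme_point_of C + quadrant" "s \<in> C" "fst s \<le> fst p" "snd s \<le> snd p"
  shows "s = p"
proof (rule ccontr)
  assume "s \<noteq> p"
  have "s + (2 *\<^sub>R (p - s)) \<in> C + quadrant" "s + 0 \<in> C + quadrant"
    using assms(2-4) by (intro set_plus_intro; simp)+
  moreover have "p = midpoint s (s + 2 *\<^sub>R (p - s))"
    by (simp add: midpoint_def prod_eq_iff field_simps)
  then have "p \<in> open_segment s (s + 2 *\<^sub>R (p - s))"
    using \<open>s \<noteq> p\<close> midpoint_in_open_segment[of s "s + 2 *\<^sub>R (p - s)"] by simp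
  ultimately show False
    using assms(1) by (simp add: extreme_point_of_def)
qed

text \<open>The quotients are the lower bound that \<open>q\<close> and the upper bound that
  \<open>r\<close> impose on a weight favouring \<open>p\<close>. If they clashed, the segment from
  \<open>q\<close> to \<open>r\<close> would cross the height of \<open>p\<close> at
  \<open>p\<close> or to its left; non-domination makes the crossing point \<open>p\<close> itself,
  inside the segment.\<close>

lemma extreme_point_slopes:
  assumes p: "p extreme_point_of C + quadrant" and C: "convex C" and qr: "q \<in> C" "r \<in> C"
    and q: "snd p < snd q" and r: "snd r < snd p"
  shows "(fst p - fst q) / (snd q - snd p) < (fst r - fst p) / (snd p - snd r)"
proof (rule ccontr)
  assume neg: "\<not> ?thesis"
  define b d where "b = snd q - snd p" and "d = snd p - snd r"
  have bd: "0 < b" "0 < d" using q r by (auto simp: b_def d_def)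
  \<comment> \<open>the weight that puts \<open>s\<close> at the height of \<open>p\<close>\<close>
  define t where "t = b / (b + d)"
  define s where "s = (1 - t) *\<^sub>R q + t *\<^sub>R r"
  have t: "0 < t" "t < 1" using bd by (auto simp: t_def)
  have sC: "s \<in> C" unfolding s_def using C qr t by (intro convexD) auto
  \<comment> \<open>Multiplying by \<open>b + d\<close> clears the denominators, so both coordinates
    of \<open>s\<close> can be compared with those of \<open>p\<close> without division.\<close>
  have wt: "(b + d) * (1 - t) = d" "(b + d) * t = b" using bd by (simp_all add: t_def field_simps)
  have comb: "(b + d) * ((1 - t) * x + t * y) = d * x + b * y" for x y
    unfolding distrib_left mult.assoc[symmetric] wt ..
  have "(b + d) * snd s = d * snd q + b * snd r"
    using comb by (simp add: s_def)
  also have "\<dots> = (b + d) * snd p" by (simp add: b_def d_def algebra_simps)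
  finally have snd: "snd s = snd p" using bd by simp
  have "(b + d) * fst s = d * fst q + b * fst r"
    using comb by (simp add: s_def)
  also have "\<dots> \<le> (b + d) * fst p"
    using neg bd by (simp add: b_def[symmetric] d_def[symmetric] field_simps not_less)
  finally have "fst s \<le> fst p" using bd by simp
  with p sC snd have "s = p" by (intro extreme_point_not_dominated) auto
  then have "p \<in> open_segment q r"
    using t q r unfolding in_segment s_def by auto
  moreover have "q + 0 \<in> C + quadrant" "r + 0 \<in> C + quadrant"
    using qr by (intro set_plus_intro; simp)+
  ultimately show False using p by (simp add: extreme_point_of_def)
qed

text \<open>Each competing point bounds \<open>l\<close> strictly from one side, according to its
  height relative to \<open>p\<close>. The bounds are pairwise compatible, and finiteness of
  \<open>P\<close> yields one \<open>l\<close> meeting all of them.\<close>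

lemma extreme_point_unique_minimum:
  assumes p: "p extreme_point_of convex hull P + quadrant" and "finite P"
  shows "\<exists>l\<ge>0. \<forall>q\<in>P. q \<noteq> p \<longrightarrow> fst p + l * snd p < fst q + l * snd q"
proof -
  \<comment> \<open>Points above \<open>p\<close> give lower bounds, points below give upper bounds.
    The extra \<open>0\<close> forces a nonnegative weight.\<close>
  define L where "L = insert 0 ((\<lambda>q. (fst p - fst q) / (snd q - snd p)) ` {q\<in>P. snd p < snd q})"
  define U where "U = (\<lambda>r. (fst r - fst p) / (snd p - snd r)) ` {r\<in>P. snd r < snd p}"
  \<comment> \<open>This makes the bounds in \<open>U\<close> positive, hence compatible with
    \<open>0\<close>, and settles points at the height of \<open>p\<close> for every
    \<open>l\<close>.\<close>
  have dom: "fst p < fst q" if "q \<in> P" "q \<noteq> p" "snd q \<le> snd p" for q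
    using extreme_point_not_dominated[OF p hull_inc[OF that(1)]] that by force
  have "a < b" if "a \<in> L" "b \<in> U" for a b
    using that extreme_point_slopes[OF p convex_convex_hull hull_inc hull_inc] dom
    unfolding L_def U_def by (force intro: divide_pos_pos)
  moreover have "finite L" "finite U" using \<open>finite P\<close> by (auto simp: L_def U_def)
  ultimately obtain l where l: "\<And>a. a \<in> L \<Longrightarrow> a < l" "\<And>b. b \<in> U \<Longrightarrow> l < b"
    using finite_sets_separated by metis
  have "fst p + l * snd p < fst q + l * snd q" if q: "q \<in> P" "q \<noteq> p" for q
  proof (rule linorder_cases[of "snd p" "snd q"])
    assume *: "snd p < snd q"
    then have "(fst p - fst q) / (snd q - snd p) < l" using q by (intro l) (auto simp: L_def)
    with * show ?thesis by (simp add: field_simps)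
  next
    assume "snd p = snd q"
    with dom[OF q] show ?thesis by simp
  next
    assume *: "snd q < snd p"
    then have "l < (fst q - fst p) / (snd p - snd q)" using q by (intro l) (auto simp: U_def)
    with * show ?thesis by (simp add: field_simps)
  qed
  moreover have "0 \<le> l" using l(1)[of 0] by (simp add: L_def)
  ultimately show ?thesis by blast
qed

section \<open>Lexicographic minima as vertices\<close>

lemma convex_lex_ge:
  fixes g h :: "'a :: real_vector \<Rightarrow> real"
  assumes "linear g" "linear h"
  shows "convex {v. a < g v \<or> a = g v \<and> b \<le> h v}"
proof -
  show ?thesis
  proof (rule convexI)
    fix x y :: 'a and u v :: real
    assume x: "x \<in> {v. a < g v \<or> a = g v \<and> b \<le> h v}" and y: "y \<in> {v. a < g v \<or> a = g v \<and> b \<le> h v}"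
      and uv: "0 \<le> u" "0 \<le> v" "u + v = 1"
    consider "u = 0" | "v = 0" | "0 < u" "0 < v" using uv by linarith
    then show "u *\<^sub>R x + v *\<^sub>R y \<in> {v. a < g v \<or> a = g v \<and> b \<le> h v}"
    proof cases
      case 3
      have lin: "g (u *\<^sub>R x + v *\<^sub>R y) = u * g x + v * g y" "h (u *\<^sub>R x + v *\<^sub>R y) = u * h x + v * h y"
        using assms by (simp_all add: linear_add linear_cmul)
      have ab: "a = u * a + v * a" "b = u * b + v * b"
        using uv(3) by (simp_all flip: distrib_right)
      \<comment> \<open>With both weights positive, \<open>g\<close> stays at \<open>a\<close> only
        if both points lie on \<open>g = a\<close>, where the bound on \<open>h\<close> carries
        over; otherwise one strict inequality makes the combination strict.\<close>
      show ?thesis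
      proof (cases "a = g x \<and> a = g y")
        case True
        then have "u * b \<le> u * h x" "v * b \<le> v * h y" using x y uv by (auto intro: mult_left_mono)
        with True ab lin show ?thesis by auto
      next
        case False
        have "u * a \<le> u * g x" "v * a \<le> v * g y" using x y uv by (auto intro: mult_left_mono)
        moreover have "u * a < u * g x \<or> v * a < v * g y" using False x y 3 by auto
        ultimately show ?thesis using ab lin by auto
      qed
    qed (use x y uv in auto)
  qed
qed

text \<open>Minimality of \<open>g\<close> alone only reaches a face, possibly an edge; the
  tie-break by \<open>snd\<close> singles out an endpoint. Convexity of the lexicographic upper set
  \<open>M\<close> extends minimality from \<open>P\<close> to the whole sum with the
  quadrant.\<close>

lemma lex_minimum_extreme_point:
  fixes P :: "(real \<times> real) set" and l :: real
  defines "g \<equiv> \<lambda>v :: real \<times> real. fst v + l * snd v"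
  assumes "p \<in> P" "0 \<le> l" and min: "\<And>q. q \<in> P \<Longrightarrow> g p < g q \<or> g p = g q \<and> snd p \<le> snd q"
  shows "p extreme_point_of convex hull P + quadrant"
proof -
  define M where "M = {v. g p < g v \<or> g p = g v \<and> snd p \<le> snd v}"
  have lin: "linear g" unfolding g_def by (intro linearI) (auto simp: algebra_simps)
  have "convex M" unfolding M_def by (intro convex_lex_ge lin linear_snd)
  then have hullM: "convex hull P \<subseteq> M" using min by (intro hull_minimal) (auto simp: M_def)
  have VM: "v \<in> M" if "v \<in> convex hull P + quadrant" for v
  proof -
    from that obtain s u where v: "v = s + u" "s \<in> M" "0 \<le> fst u" "0 \<le> snd u"
      using hullM by (auto elim!: set_plus_elim)
    \<comment> \<open>Adding a quadrant vector decreases neither \<open>g\<close>, because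
      \<open>l \<ge> 0\<close>, nor \<open>snd\<close>.\<close>
    have "g v = g s + g u" "0 \<le> g u" using v \<open>0 \<le> l\<close> by (auto simp: g_def algebra_simps)
    then show ?thesis using v by (auto simp: M_def)
  qed
  show ?thesis
    unfolding extreme_point_of_def
  proof (intro conjI ballI notI)
    have "p + 0 \<in> convex hull P + quadrant"
      using \<open>p \<in> P\<close> by (intro set_plus_intro hull_inc) auto
    then show "p \<in> convex hull P + quadrant" by simp
  next
    fix a b assume ab: "a \<in> convex hull P + quadrant" "b \<in> convex hull P + quadrant"
      and "p \<in> open_segment a b"
    then obtain u where u: "a \<noteq> b" "0 < u" "u < 1" "p = (1 - u) *\<^sub>R a + u *\<^sub>R b"
      by (auto simp: in_segment)
    \<comment> \<open>Applied first to \<open>g\<close> and then to \<open>snd\<close>, whose bounds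
      hold only once the \<open>g\<close> values agree. Together these two functionals determine a
      point.\<close>
    have combine: "x = c \<and> y = c" if "c = (1 - u) * x + u * y" "c \<le> x" "c \<le> y" for c x y :: real
    proof -
      have "(1 - u) * (x - c) + u * (y - c) = 0" using that(1) by (simp add: algebra_simps)
      with that(2,3) u(2,3) show ?thesis
        by (smt (verit) mult_nonneg_nonneg mult_pos_pos)
    qed
    have "g p = (1 - u) * g a + u * g b"
      unfolding u(4) using lin by (simp add: linear_add linear_cmul)
    moreover have "g p \<le> g a" "g p \<le> g b" using VM[OF ab(1)] VM[OF ab(2)] by (auto simp: M_def)
    ultimately have g: "g a = g p \<and> g b = g p" by (rule combine)
    have "snd p = (1 - u) * snd a + u * snd b" unfolding u(4) by simp
    moreover have "snd p \<le> snd a" "snd p \<le> snd b"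
      using VM[OF ab(1)] VM[OF ab(2)] g by (auto simp: M_def)
    ultimately have "snd a = snd p \<and> snd b = snd p" by (rule combine)
    with g have "a = b" by (auto simp: g_def prod_eq_iff)
    with u(1) show False by simp
  qed
qed

lemma ex_lex_minimum:
  fixes g h :: "'a \<Rightarrow> 'b :: linorder"
  assumes "finite X" "X \<noteq> {}"
  shows "\<exists>x\<in>X. \<forall>y\<in>X. g x < g y \<or> g x = g y \<and> h x \<le> h y"
proof -
  define Y where "Y = {x\<in>X. \<forall>y\<in>X. g x \<le> g y}"
  have "finite Y" "Y \<noteq> {}"
    using assms ex_is_arg_min_if_finite[of X g] by (auto simp: Y_def is_arg_min_linorder)
  then obtain x where "x \<in> Y" "\<forall>y\<in>Y. h x \<le> h y"
    using ex_is_arg_min_if_finite[of Y h] by (auto simp: is_arg_min_linorder)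
  then show ?thesis unfolding Y_def by (force simp: order.order_iff_strict)
qed

section \<open>Representatives of vertices and the two claims\<close>

lemma maximal_inequivalent_efficient_represents:
  assumes "maximal_inequivalent_efficient X chat B E" "x \<in> efficient_extreme X chat B"
  shows "\<exists>e\<in>E. F chat B e = F chat B x"
proof (rule ccontr)
  assume neg: "\<not> ?thesis"
  \<comment> \<open>With no element of \<open>E\<close> sharing the value of \<open>x\<close>,
    adding \<open>x\<close> creates no equivalent pair, so maximality puts \<open>x\<close> into
    \<open>E\<close>.\<close>
  then have "inequivalent_efficient X chat B (insert x E)"
    using assms unfolding maximal_inequivalent_efficient_def inequivalent_efficient_def equivalent_def
    by force
  then have "insert x E = E"
    using assms(1) unfolding maximal_inequivalent_efficient_def by blast
  with neg show False by blast
qed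

theorem lemma1:
  fixes X :: "(real ^ 'n) set" and chat :: "real ^ 'n" and B Emin :: "(real ^ 'n) set"
  assumes "X \<noteq> {}"
    and "X \<subseteq> {x. \<forall>i. x $ i \<in> {0, 1}}"
    and "\<forall>i. 0 \<le> chat $ i"
    and "convex B"
    and "0 \<in> B"
    and "\<forall>x\<in>X. \<exists>c\<in>B. \<forall>c'\<in>B. c' \<bullet> x \<le> c \<bullet> x"
    and "maximal_inequivalent_efficient X chat B Emin"
  shows "Emin \<subseteq> X \<and> contains_optimum_for_all_sizes X chat B Emin \<and>
    (\<forall>S. S \<subseteq> X \<and> contains_optimum_for_all_sizes X chat B S \<longrightarrow> card Emin \<le> card S)"
proof (intro conjI allI impI)
  let ?F = "F chat B"
  define g where "g l x = fst (?F x) + l * snd (?F x)" for l x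
  have fin: "finite X" using assms(2) finite_binary_vectors by (rule finite_subset)
  \<comment> \<open>Inequivalence is injectivity of \<open>?F\<close>, so counting
    \<open>Emin\<close> amounts to counting the vertices it attains.\<close>
  have Emin: "Emin \<subseteq> efficient_extreme X chat B" "inj_on ?F Emin"
    using assms(7) unfolding maximal_inequivalent_efficient_def inequivalent_efficient_def
      equivalent_def inj_on_def by auto
  then show EX: "Emin \<subseteq> X" by (auto simp: efficient_extreme_def)
  have opt: "robust_optimal X chat B l x \<longleftrightarrow> x \<in> X \<and> (\<forall>y\<in>X. g l x \<le> g l y)" if "0 \<le> l" for l x
  proof -
    have "worst_case (uncertainty_set chat B l) y = g l y" if "y \<in> X" for y
      using assms(6) that \<open>0 \<le> l\<close> unfolding g_def by (metis worst_case_uncertainty_set)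
    then show ?thesis unfolding robust_optimal_def is_arg_min_linorder by auto
  qed
  show "contains_optimum_for_all_sizes X chat B Emin"
    unfolding contains_optimum_for_all_sizes_def
  proof (intro allI impI)
    fix l :: real assume l: "0 \<le> l"
    obtain x where x: "x \<in> X"
        "\<And>y. y \<in> X \<Longrightarrow> g l x < g l y \<or> g l x = g l y \<and> snd (?F x) \<le> snd (?F y)"
      using ex_lex_minimum[OF fin assms(1), of "g l" "\<lambda>x. snd (?F x)"] by blast
    have "?F x extreme_point_of V X chat B"
      unfolding V_def
    proof (rule lex_minimum_extreme_point[OF imageI[OF x(1)] l])
      fix q assume "q \<in> ?F ` X"
      then obtain y where "y \<in> X" "q = ?F y" by blast
      with x(2) show "fst (?F x) + l * snd (?F x) < fst q + l * snd q \<or>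
          fst (?F x) + l * snd (?F x) = fst q + l * snd q \<and> snd (?F x) \<le> snd q"
        by (simp add: g_def)
    qed
    \<comment> \<open>The minimiser \<open>x\<close> itself may be missing from \<open>Emin\<close>,
      but \<open>e\<close> has the same image and thus the same objective value.\<close>
    then obtain e where e: "e \<in> Emin" "?F e = ?F x"
      using maximal_inequivalent_efficient_represents[OF assms(7)] x(1)
      by (auto simp: efficient_extreme_def)
    then have "robust_optimal X chat B l e"
      using x EX opt[OF l] by (force simp: g_def)
    with e(1) show "\<exists>x\<in>Emin. robust_optimal X chat B l x" by blast
  qed
  fix S assume S: "S \<subseteq> X \<and> contains_optimum_for_all_sizes X chat B S"
  have "?F ` Emin \<subseteq> ?F ` S"
  proof (intro image_subsetI)
    fix x assume "x \<in> Emin"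
    then have x: "x \<in> X" "?F x extreme_point_of V X chat B"
      using Emin(1) by (auto simp: efficient_extreme_def)
    \<comment> \<open>At this size the vertex is the only image with minimal objective value, so the
      optimum that \<open>S\<close> contains must map to it.\<close>
    then obtain l where l: "0 \<le> l" "\<forall>q\<in>?F ` X. q \<noteq> ?F x \<longrightarrow> g l x < fst q + l * snd q"
      using extreme_point_unique_minimum[of "?F x" "?F ` X"] fin unfolding V_def g_def by auto
    obtain y where y: "y \<in> S" "robust_optimal X chat B l y"
      using S l(1) unfolding contains_optimum_for_all_sizes_def by blast
    then have "y \<in> X" "g l y \<le> g l x" using opt[OF l(1)] x(1) by auto
    with l(2) have "?F y = ?F x" by (force simp: g_def)
    with y(1) show "?F x \<in> ?F ` S" by (metis imageI)
  qed
  \<comment> \<open>Finiteness rules out the default value \<open>0\<close> of \<open>card\<close>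
    on infinite sets.\<close>
  moreover have "finite S" using S fin finite_subset by blast
  ultimately show "card Emin \<le> card S"
    using surj_card_le[of S "?F ` Emin" ?F] Emin(2) by (simp add: card_image)
qed

end
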